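(* For any (finite, simple) graph $F$ and any integer $r\ge 2$, we have $$\mathrm{ex}_r(n,F^{(r)+})=\mathrm{ex}(n,K_r,F)+O(n^{r-1})$$ as $n\to\infty$, where the implied constant depends only on $F$ and $r$.
   Context: An $r$-graph is an $r$-uniform hypergraph. Given a graph $F$ and $r\ge 2$, the $r$-uniform expansion $F^{(r)+}$ is the $r$-graph obtained from $F$ by adding $r-2$ new vertices to each edge of $F$, so that the $(r-2)|E(F)|$ new vertices are pairwise distinct and not in $V(F)$ (so $F^{(2)+}=F$). A hypergraph (or graph) is $\mathcal{F}$-free if it contains no copy of $\mathcal{F}$ as a (not necessarily induced) subhypergraph. $\mathrm{ex}_r(n,\mathcal{F})$ is the largest number of hyperedges in an $n$-vertex $\mathcal{F}$-free $r$-graph. $\mathrm{ex}(n,K_r,F)$ is the largest number of copies of the complete graph $K_r$ in an $n$-vertex $F$-free graph. *)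

theory Defs
  imports Complex_Main "HOL-Library.Landau_Symbols"
begin

text \<open>A hypergraph is a pair of a vertex set and an edge set; isolated vertices are allowed.
  Finite simple graphs are exactly the 2-uniform hypergraphs.\<close>

type_synonym 'a hypergraph = "'a set \<times> 'a set set"

abbreviation verts :: "'a hypergraph \<Rightarrow> 'a set" where "verts \<equiv> fst"
abbreviation edges :: "'a hypergraph \<Rightarrow> 'a set set" where "edges \<equiv> snd"

definition uniform_hypergraph :: "nat \<Rightarrow> 'a hypergraph \<Rightarrow> bool" where
  "uniform_hypergraph r G \<longleftrightarrow>
     finite (verts G) \<and> (\<forall>e\<in>edges G. e \<subseteq> verts G \<and> card e = r)"

abbreviation simple_graph :: "'a hypergraph \<Rightarrow> bool" where
  "simple_graph \<equiv> uniform_hypergraph 2"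

definition subhypergraph :: "'a hypergraph \<Rightarrow> 'a hypergraph \<Rightarrow> bool" where
  "subhypergraph G' G \<longleftrightarrow> verts G' \<subseteq> verts G \<and> edges G' \<subseteq> edges G"

definition isomorphic :: "'a hypergraph \<Rightarrow> 'b hypergraph \<Rightarrow> bool" where
  "isomorphic H G \<longleftrightarrow>
     (\<exists>f. bij_betw f (verts H) (verts G) \<and> edges G = (\<lambda>e. f ` e) ` edges H)"

text \<open>Copies are unlabelled: a copy of \<open>H\<close> in \<open>G\<close> is a subhypergraph of \<open>G\<close>, not necessarily
  induced, that is isomorphic to \<open>H\<close>.\<close>

definition copies :: "'b hypergraph \<Rightarrow> 'a hypergraph \<Rightarrow> 'a hypergraph set" where
  "copies H G = {G'. subhypergraph G' G \<and> isomorphic H G'}"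

definition is_free :: "'b hypergraph \<Rightarrow> 'a hypergraph \<Rightarrow> bool" where
  "is_free H G \<longleftrightarrow> copies H G = {}"

definition complete_graph :: "nat \<Rightarrow> nat hypergraph" where
  "complete_graph r = ({..<r}, {e. e \<subseteq> {..<r} \<and> card e = 2})"

text \<open>The new vertices attached to the edge \<open>e\<close> are \<open>Inr (e, i)\<close> for \<open>i < r - 2\<close>.
  Only meaningful for \<open>r \<ge> 2\<close>, because of truncated subtraction.\<close>

definition expansion :: "nat \<Rightarrow> 'a hypergraph \<Rightarrow> ('a + 'a set \<times> nat) hypergraph" where
  "expansion r F =
     (Inl ` verts F \<union> Inr ` (edges F \<times> {..<r - 2}),
      (\<lambda>e. Inl ` e \<union> Inr ` ({e} \<times> {..<r - 2})) ` edges F)"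

text \<open>In the two extremal numbers the host vertices are natural numbers, which is no restriction
  up to isomorphism. The sets below are finite, so \<open>Sup\<close> is their maximum; if no \<open>n\<close>-vertex
  host is free (which for large \<open>n\<close> happens only if the forbidden hypergraph has no edges),
  the set is empty and the value is \<open>0\<close>.\<close>

definition ex_uniform :: "nat \<Rightarrow> nat \<Rightarrow> 'b hypergraph \<Rightarrow> nat" where
  "ex_uniform r n H =
     Sup {card (edges G) | G :: nat hypergraph.
            uniform_hypergraph r G \<and> card (verts G) = n \<and> is_free H G}"

definition ex_count :: "nat \<Rightarrow> 'c hypergraph \<Rightarrow> 'b hypergraph \<Rightarrow> nat" where
  "ex_count n H F =
     Sup {card (copies H G) | G :: nat hypergraph.
            simple_graph G \<and> card (verts G) = n \<and> is_free F G}"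

end

theory Submission
  imports Defs
begin

text \<open>The \<open>r\<close>-cliques of an \<open>F\<close>-free graph form an \<open>F\<^bsup>(r)+\<^esup>\<close>-free \<open>r\<close>-graph. Conversely, from an
  \<open>F\<^bsup>(r)+\<^esup>\<close>-free \<open>r\<close>-graph delete repeatedly the hyperedges through an \<open>(r - 1)\<close>-set of bounded
  positive codegree; this costs \<open>O(n\<^bsup>r-1\<^esup>)\<close> hyperedges. In what remains every \<open>(r - 1)\<close>-set in the
  shadow has large codegree, so the vertices of a hyperedge outside a given pair can be exchanged
  one by one to avoid any bounded set. A copy of \<open>F\<close> in the graph of covered pairs would thus
  extend greedily to a copy of \<open>F\<^bsup>(r)+\<^esup>\<close>; hence that graph is \<open>F\<close>-free, and the remaining
  hyperedges are \<open>r\<close>-cliques in it.\<close>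

section \<open>Containment as existence of an embedding\<close>

text \<open>Copies need not be induced, so the image of \<open>H\<close> under \<open>f\<close> is
  itself a copy; conversely, an isomorphism onto a subhypergraph is such an
  \<open>f\<close>.\<close>

lemma not_is_free_iff:
  "\<not> is_free H G \<longleftrightarrow>
     (\<exists>f. inj_on f (verts H) \<and> f ` verts H \<subseteq> verts G \<and> (\<forall>e\<in>edges H. f ` e \<in> edges G))"
proof
  assume "\<not> is_free H G"
  then show "\<exists>f. inj_on f (verts H) \<and> f ` verts H \<subseteq> verts G \<and> (\<forall>e\<in>edges H. f ` e \<in> edges G)"
    by (fastforce simp: is_free_def copies_def subhypergraph_def isomorphic_def bij_betw_def)
next
  assume "\<exists>f. inj_on f (verts H) \<and> f ` verts H \<subseteq> verts G \<and> (\<forall>e\<in>edges H. f ` e \<in> edges G)"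
  then obtain f where f: "inj_on f (verts H)" "f ` verts H \<subseteq> verts G"
    "\<forall>e\<in>edges H. f ` e \<in> edges G" by blast
  have "(f ` verts H, (\<lambda>e. f ` e) ` edges H) \<in> copies H G"
    using f by (auto simp: copies_def subhypergraph_def isomorphic_def bij_betw_def)
  then show "\<not> is_free H G" by (auto simp: is_free_def)
qed

lemma uniform_hypergraph_edges_subset:
  "uniform_hypergraph r G \<Longrightarrow> edges G \<subseteq> Pow (verts G)"
  by (auto simp: uniform_hypergraph_def)

lemma uniform_hypergraph_finite_edges:
  "uniform_hypergraph r G \<Longrightarrow> finite (edges G)"
  by (meson finite_Pow_iff finite_subset uniform_hypergraph_def uniform_hypergraph_edges_subset)

section \<open>Copies of the complete graph as vertex sets\<close>

definition cliques :: "nat \<Rightarrow> 'a hypergraph \<Rightarrow> 'a set set" where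
  "cliques r G = {S. S \<subseteq> verts G \<and> card S = r \<and> (\<forall>p. p \<subseteq> S \<and> card p = 2 \<longrightarrow> p \<in> edges G)}"

lemma image_card_subsets:
  assumes "bij_betw f A B"
  shows "(\<lambda>p. f ` p) ` {p. p \<subseteq> A \<and> card p = k} = {p. p \<subseteq> B \<and> card p = k}"
proof -
  have inj: "inj_on f A" and B: "B = f ` A" using assms by (auto simp: bij_betw_def)
  show ?thesis
  proof (intro equalityI subsetI)
    fix q assume "q \<in> (\<lambda>p. f ` p) ` {p. p \<subseteq> A \<and> card p = k}"
    then show "q \<in> {p. p \<subseteq> B \<and> card p = k}"
      using inj B by (auto simp: card_image inj_on_subset)
  next
    fix q assume q: "q \<in> {p. p \<subseteq> B \<and> card p = k}"
    then obtain p where "p \<subseteq> A" "q = f ` p" using B by (auto elim: subset_imageE)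
    moreover from this have "card p = k"
      using q inj by (auto simp: card_image inj_on_subset)
    ultimately show "q \<in> (\<lambda>p. f ` p) ` {p. p \<subseteq> A \<and> card p = k}" by blast
  qed
qed

text \<open>A copy of the complete graph has every pair of its vertices as an edge, so its vertex
  set determines it. Unlabelled copies can therefore be counted as vertex sets, which are also the
  hyperedges to be compared with.\<close>

lemma copies_complete_graph:
  assumes "finite (verts G)"
  shows "copies (complete_graph r) G = (\<lambda>S. (S, {p. p \<subseteq> S \<and> card p = 2})) ` cliques r G"
proof (intro equalityI subsetI)
  fix K assume "K \<in> copies (complete_graph r) G"
  then obtain f where sub: "subhypergraph K G" and f: "bij_betw f {..<r} (verts K)"
    and E: "edges K = (\<lambda>e. f ` e) ` {e. e \<subseteq> {..<r} \<and> card e = 2}"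
    by (auto simp: copies_def isomorphic_def complete_graph_def)
  have E': "edges K = {p. p \<subseteq> verts K \<and> card p = 2}"
    using E image_card_subsets[OF f] by simp
  moreover have "card (verts K) = r" using bij_betw_same_card[OF f] by simp
  ultimately have "verts K \<in> cliques r G"
    using sub by (auto simp: cliques_def subhypergraph_def)
  then show "K \<in> (\<lambda>S. (S, {p. p \<subseteq> S \<and> card p = 2})) ` cliques r G"
    by (rule rev_image_eqI) (simp add: prod_eq_iff E')
next
  fix K assume "K \<in> (\<lambda>S. (S, {p. p \<subseteq> S \<and> card p = 2})) ` cliques r G"
  then obtain S where S: "S \<in> cliques r G" and K: "K = (S, {p. p \<subseteq> S \<and> card p = 2})" by blast
  have "finite S" "card S = r" using S assms by (auto simp: cliques_def intro: finite_subset)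
  then obtain f where "bij_betw f {..<r} S"
    by (metis card_lessThan finite_lessThan finite_same_card_bij)
  then have "isomorphic (complete_graph r) K"
    unfolding isomorphic_def complete_graph_def K
    by (intro exI[of _ f]) (simp add: image_card_subsets)
  moreover have "subhypergraph K G" using S K by (auto simp: cliques_def subhypergraph_def)
  ultimately show "K \<in> copies (complete_graph r) G" by (simp add: copies_def)
qed

lemma card_copies_complete_graph:
  "finite (verts G) \<Longrightarrow> card (copies (complete_graph r) G) = card (cliques r G)"
  by (simp add: copies_complete_graph card_image inj_on_def)

section \<open>Bounds for the two suprema\<close>

lemma card_le_ex_uniform:
  fixes G :: "nat hypergraph"
  assumes "uniform_hypergraph r G" "card (verts G) = n" "is_free H G"
  shows "card (edges G) \<le> ex_uniform r n H"
  unfolding ex_uniform_def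
proof (rule cSup_upper)
  show "bdd_above {card (edges G) | G :: nat hypergraph.
          uniform_hypergraph r G \<and> card (verts G) = n \<and> is_free H G}"
  \<comment> \<open>\<open>Sup\<close> on \<open>nat\<close> dominates only bounded sets; the size
    of the power set of the vertices is a crude but sufficient bound.\<close>
  proof (rule bdd_aboveI[of _ "2 ^ n"])
    fix x assume "x \<in> {card (edges G) | G :: nat hypergraph.
          uniform_hypergraph r G \<and> card (verts G) = n \<and> is_free H G}"
    then obtain G :: "nat hypergraph" where G: "uniform_hypergraph r G" "card (verts G) = n"
      and x: "x = card (edges G)" by blast
    have fin: "finite (verts G)" using G by (simp add: uniform_hypergraph_def)
    show "x \<le> 2 ^ n"
      using card_mono[OF _ uniform_hypergraph_edges_subset[OF G(1)]] fin G(2) x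
      by (simp add: card_Pow)
  qed
qed (use assms in blast)

lemma card_cliques_le_ex_count:
  fixes G :: "nat hypergraph"
  assumes "simple_graph G" "card (verts G) = n" "is_free F G"
  shows "card (cliques r G) \<le> ex_count n (complete_graph r) F"
proof -
  have "card (copies (complete_graph r) G) \<le> ex_count n (complete_graph r) F"
    unfolding ex_count_def
  proof (rule cSup_upper)
    show "bdd_above {card (copies (complete_graph r) G) | G :: nat hypergraph.
            simple_graph G \<and> card (verts G) = n \<and> is_free F G}"
    proof (rule bdd_aboveI[of _ "2 ^ n"])
      fix x assume "x \<in> {card (copies (complete_graph r) G) | G :: nat hypergraph.
            simple_graph G \<and> card (verts G) = n \<and> is_free F G}"
      then obtain G :: "nat hypergraph" where G: "simple_graph G" "card (verts G) = n"
        and x: "x = card (copies (complete_graph r) G)" by blast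
      have fin: "finite (verts G)" using G by (simp add: uniform_hypergraph_def)
      have "cliques r G \<subseteq> Pow (verts G)" by (auto simp: cliques_def)
      from card_mono[OF _ this] show "x \<le> 2 ^ n"
        using fin G(2) x by (simp add: card_Pow card_copies_complete_graph)
    qed
  qed (use assms in blast)
  then show ?thesis
    using assms(1) by (simp add: card_copies_complete_graph uniform_hypergraph_def)
qed

text \<open>Extends \<open>cSup_least\<close> to the empty set, where \<open>Sup\<close> is 0 on
  \<open>nat\<close>; this case arises when no host on \<open>n\<close> vertices is free.\<close>

lemma Sup_nat_le:
  fixes S :: "nat set"
  assumes "\<And>x. x \<in> S \<Longrightarrow> x \<le> M"
  shows "Sup S \<le> M"
proof (cases "S = {}")
  case False
  then show ?thesis using assms by (rule cSup_least)
qed (simp add: Sup_nat_def)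

section \<open>Lower bound: the hypergraph of cliques\<close>

text \<open>Restrict an embedding of the expansion to the old vertices \<open>Inl\<close>: each edge
  of \<open>F\<close> lands inside a clique of \<open>G\<close>, hence on an edge of
  \<open>G\<close>, which gives a copy of \<open>F\<close>.\<close>

lemma expansion_free_cliques:
  assumes F: "simple_graph F" and free: "is_free F G"
  shows "is_free (expansion r F) (verts G, cliques r G)"
proof (rule ccontr)
  assume "\<not> is_free (expansion r F) (verts G, cliques r G)"
  then obtain h where inj: "inj_on h (verts (expansion r F))"
    and sub: "h ` verts (expansion r F) \<subseteq> verts G"
    and E: "\<forall>e\<in>edges (expansion r F). h ` e \<in> cliques r G"
    by (auto simp: not_is_free_iff)
  have inj': "inj_on (h \<circ> Inl) (verts F)"
    using inj by (auto simp: expansion_def inj_on_def)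
  have "(h \<circ> Inl) ` e \<in> edges G" if "e \<in> edges F" for e
  proof -
    have e: "e \<subseteq> verts F" "card e = 2" using F that by (auto simp: uniform_hypergraph_def)
    have "h ` (Inl ` e \<union> Inr ` ({e} \<times> {..<r - 2})) \<in> cliques r G"
      using E that by (auto simp: expansion_def)
    moreover have "(h \<circ> Inl) ` e \<subseteq> h ` (Inl ` e \<union> Inr ` ({e} \<times> {..<r - 2}))" by auto
    moreover have "card ((h \<circ> Inl) ` e) = 2"
      using card_image[OF inj_on_subset[OF inj' e(1)]] e(2) by simp
    ultimately show ?thesis unfolding cliques_def by blast
  qed
  moreover have "(h \<circ> Inl) ` verts F \<subseteq> verts G"
    using sub by (auto simp: expansion_def)
  ultimately have "\<not> is_free F G"
    unfolding not_is_free_iff using inj' by blast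
  then show False using free by simp
qed

lemma ex_count_le_ex_uniform:
  assumes "simple_graph F"
  shows "ex_count n (complete_graph r) F \<le> ex_uniform r n (expansion r F)"
  unfolding ex_count_def
proof (rule Sup_nat_le)
  fix x assume "x \<in> {card (copies (complete_graph r) G) | G :: nat hypergraph.
            simple_graph G \<and> card (verts G) = n \<and> is_free F G}"
  then obtain G :: "nat hypergraph" where G: "simple_graph G" "card (verts G) = n" "is_free F G"
    and x: "x = card (copies (complete_graph r) G)" by blast
  have fin: "finite (verts G)" using G by (simp add: uniform_hypergraph_def)
  have "uniform_hypergraph r (verts G, cliques r G)"
    using fin by (auto simp: uniform_hypergraph_def cliques_def)
  from card_le_ex_uniform[OF this _ expansion_free_cliques[OF assms G(3)]]
  show "x \<le> ex_uniform r n (expansion r F)"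
    using G(2) x fin by (simp add: card_copies_complete_graph)
qed

section \<open>Cleaning to large codegree\<close>

definition shadow :: "'a set set \<Rightarrow> 'a set set" where
  "shadow E = {e - {w} | e w. e \<in> E \<and> w \<in> e}"

text \<open>Kept as a set of vertices, so that \<open>card (link E T)\<close> is the codegree of
  \<open>T\<close>.\<close>

definition link :: "'a set set \<Rightarrow> 'a set \<Rightarrow> 'a set" where
  "link E T = {w. w \<notin> T \<and> insert w T \<in> E}"

lemma link_in_shadow: "link E T \<noteq> {} \<longleftrightarrow> T \<in> shadow E"
  by (auto simp: link_def shadow_def insert_absorb) (metis Diff_insert_absorb insertI1)

lemma finite_shadow:
  assumes "finite E" "\<forall>e\<in>E. finite e"
  shows "finite (shadow E)"
proof -
  have "shadow E = (\<Union>e\<in>E. (\<lambda>w. e - {w}) ` e)" by (auto simp: shadow_def)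
  then show ?thesis using assms by auto
qed

text \<open>Deleting all edges through a shadow set of codegree at most \<open>k\<close> costs at
  most \<open>k\<close> edges and removes at least that set from the shadow. So
  \<open>card E - k * card (shadow E)\<close> never decreases; the inequality says this without
  subtraction on \<open>nat\<close>.\<close>

lemma min_codegree_subfamily:
  assumes "finite E" "\<forall>e\<in>E. finite e"
  shows "\<exists>E'\<subseteq>E. (\<forall>T\<in>shadow E'. k < card (link E' T)) \<and>
           card E + k * card (shadow E') \<le> card E' + k * card (shadow E)"
  using assms
proof (induction "card E" arbitrary: E rule: less_induct)
  case less
  show ?case
  proof (cases "\<forall>T\<in>shadow E. k < card (link E T)")
    case True
    then show ?thesis by blast
  next
    case False
    then obtain T where T: "T \<in> shadow E" "card (link E T) \<le> k" by auto
    define D where "D = (\<lambda>w. insert w T) ` link E T"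
    have DE: "D \<subseteq> E" by (auto simp: D_def link_def)
    have "D \<noteq> {}" using T(1) by (simp add: D_def link_in_shadow)
    have finD: "finite D" using DE less.prems finite_subset by blast
    have "inj_on (\<lambda>w. insert w T) (link E T)" by (auto simp: inj_on_def link_def)
    then have cD: "card D \<le> k" using T(2) by (simp add: D_def card_image)
    have cED: "card E = card (E - D) + card D"
      using DE less.prems(1) finD by (metis card_Diff_subset card_mono le_add_diff_inverse2)
    have "card (E - D) < card E"
      using cED \<open>D \<noteq> {}\<close> finD by (simp add: card_gt_0_iff)
    from less.hyps[OF this] less.prems
    obtain E' where E': "E' \<subseteq> E - D" "\<forall>T\<in>shadow E'. k < card (link E' T)"
      "card (E - D) + k * card (shadow E') \<le> card E' + k * card (shadow (E - D))" by auto
    \<comment> \<open>All edges extending \<open>T\<close> by one vertex lie in \<open>D\<close>, so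
      the link of \<open>T\<close> is now empty.\<close>
    have "T \<notin> shadow (E - D)"
      unfolding link_in_shadow[symmetric] by (auto simp: D_def link_def)
    moreover have "shadow (E - D) \<subseteq> shadow E" by (auto simp: shadow_def)
    ultimately have "shadow (E - D) \<subset> shadow E" using T(1) by blast
    then have "card (shadow (E - D)) < card (shadow E)"
      using psubset_card_mono finite_shadow less.prems by metis
    \<comment> \<open>The \<open>Suc\<close> frees one summand \<open>k\<close>, which pays for the
      at most \<open>k\<close> edges of \<open>D\<close>.\<close>
    then have "k * Suc (card (shadow (E - D))) \<le> k * card (shadow E)"
      by (intro mult_le_mono2) simp
    then have "card E + k * card (shadow E') \<le> card E' + k * card (shadow E)"
      using E'(3) cED cD by simp
    then show ?thesis using E'(1,2) by blast
  qed
qed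

section \<open>Greedy choice of hyperedges\<close>

text \<open>A vertex \<open>w\<close> of \<open>e\<close> in \<open>A\<close> but outside
  \<open>P\<close> can be exchanged: the codegree of \<open>e - {w}\<close> exceeds
  \<open>card A\<close>, so some replacement lies outside \<open>A\<close>. Each exchange lowers the
  number of such vertices and keeps \<open>P\<close>.\<close>

lemma avoiding_edge:
  assumes codeg: "\<forall>T\<in>shadow E. k < card (link E T)"
    and "finite A" "card A \<le> k" "e \<in> E" "finite e" "P \<subseteq> e"
  shows "\<exists>e'\<in>E. P \<subseteq> e' \<and> e' \<inter> A \<subseteq> P"
  using assms(4-)
proof (induction "card ((e - P) \<inter> A)" arbitrary: e rule: less_induct)
  case less
  show ?case
  proof (cases "(e - P) \<inter> A = {}")
    case True
    then have "e \<inter> A \<subseteq> P" by blast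
    then show ?thesis using less.prems(1,3) by blast
  next
    case False
    then obtain w where w: "w \<in> e" "w \<notin> P" "w \<in> A" by blast
    have "e - {w} \<in> shadow E" using less.prems w by (auto simp: shadow_def)
    from bspec[OF codeg this] have "card A < card (link E (e - {w}))" using assms(3) by simp
    then have "\<not> link E (e - {w}) \<subseteq> A"
      using card_mono[OF \<open>finite A\<close>, of "link E (e - {w})"] by linarith
    then obtain w' where w': "w' \<in> link E (e - {w})" "w' \<notin> A" by blast
    define e1 where "e1 = insert w' (e - {w})"
    have "(e1 - P) \<inter> A \<subseteq> (e - P) \<inter> A - {w}" using w'(2) by (auto simp: e1_def)
    then have "(e1 - P) \<inter> A \<subset> (e - P) \<inter> A" using w by blast
    then have "card ((e1 - P) \<inter> A) < card ((e - P) \<inter> A)"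
      using less.prems(2) by (intro psubset_card_mono) simp_all
    moreover have "e1 \<in> E" using w'(1) by (simp add: e1_def link_def)
    moreover have "finite e1" "P \<subseteq> e1" using less.prems w by (auto simp: e1_def)
    ultimately show ?thesis by (rule less.hyps)
  qed
qed

text \<open>Choose the edges one at a time, each avoiding \<open>B\<close> and all earlier edges
  outside its own \<open>P j\<close>. The set to avoid has at most
  \<open>card B + r * card J\<close> elements, within the codegree bound. In the application
  \<open>B\<close> is the image of the vertices of \<open>F\<close> and \<open>P j\<close> that of
  an edge.\<close>

lemma greedy_edges:
  assumes codeg: "\<forall>T\<in>shadow E. k < card (link E T)"
    and unif: "\<forall>e\<in>E. finite e \<and> card e = r"
    and "finite J" "finite B" "card B + r * card J \<le> k"
    and cov: "\<And>j. j \<in> J \<Longrightarrow> \<exists>e\<in>E. P j \<subseteq> e"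
    and PB: "\<And>j. j \<in> J \<Longrightarrow> P j \<subseteq> B"
  shows "\<exists>g. \<forall>j\<in>J. g j \<in> E \<and> P j \<subseteq> g j \<and> g j \<inter> B = P j \<and>
           (\<forall>i\<in>J. i \<noteq> j \<longrightarrow> (g i - P i) \<inter> (g j - P j) = {})"
  using assms(3,5-)
proof (induction J)
  case empty
  then show ?case by simp
next
  case (insert x J)
  have "card B + r * card J \<le> k" using insert.prems(1) insert.hyps by simp
  then have "\<exists>g. \<forall>j\<in>J. g j \<in> E \<and> P j \<subseteq> g j \<and> g j \<inter> B = P j \<and>
      (\<forall>i\<in>J. i \<noteq> j \<longrightarrow> (g i - P i) \<inter> (g j - P j) = {})"
    by (rule insert.IH) (use insert.prems in simp_all)
  then obtain g where g: "\<forall>j\<in>J. g j \<in> E \<and> P j \<subseteq> g j \<and> g j \<inter> B = P j \<and>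
      (\<forall>i\<in>J. i \<noteq> j \<longrightarrow> (g i - P i) \<inter> (g j - P j) = {})" ..
  define A where "A = B \<union> (\<Union>j\<in>J. g j)"
  have "card (\<Union>j\<in>J. g j) \<le> (\<Sum>j\<in>J. card (g j))"
    using insert.hyps(1) by (rule card_UN_le)
  also have "\<dots> = r * card J" using g unif by simp
  finally have "card A \<le> card B + r * card J"
    unfolding A_def by (meson add_left_mono card_Un_le le_trans)
  also have "\<dots> \<le> card B + r * card (insert x J)"
    using insert.hyps by simp
  finally have "card A \<le> k" using insert.prems(1) by simp
  moreover have "finite A" using g unif insert.hyps \<open>finite B\<close> by (auto simp: A_def)
  moreover obtain e where "e \<in> E" "P x \<subseteq> e" using insert.prems(2) by blast
  ultimately obtain e' where e': "e' \<in> E" "P x \<subseteq> e'" "e' \<inter> A \<subseteq> P x"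
    using avoiding_edge[OF codeg] unif by metis
  \<comment> \<open>Avoidance of \<open>A\<close> gives one inclusion; the other holds because
    \<open>P x\<close> lies in both \<open>e'\<close> and \<open>B\<close>.\<close>
  have B: "e' \<inter> B = P x" using e' insert.prems(3)[of x] by (auto simp: A_def)
  have dis: "(e' - P x) \<inter> (g j - P j) = {}" if "j \<in> J" for j
    using e'(3) that by (auto simp: A_def)
  define g' where "g' = g(x := e')"
  have x: "g' x = e'" and J: "\<And>j. j \<in> J \<Longrightarrow> g' j = g j"
    using insert.hyps(2) by (auto simp: g'_def)
  have single: "g' j \<in> E \<and> P j \<subseteq> g' j \<and> g' j \<inter> B = P j" if "j \<in> insert x J" for j
    using that g e'(1,2) B x J by (cases "j = x") simp_all
  have "(g' i - P i) \<inter> (g' j - P j) = {}" if ij: "i \<in> insert x J" "j \<in> insert x J" "i \<noteq> j" for i j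
  proof -
    consider "i = x" "j \<in> J" | "j = x" "i \<in> J" | "i \<in> J" "j \<in> J" using ij by blast
    then show ?thesis
    proof cases
      case 1
      then show ?thesis using dis[of j] x J by simp
    next
      case 2
      then show ?thesis using dis[of i] x J by (simp add: Int_commute)
    next
      case 3
      then show ?thesis using g J ij(3) by simp
    qed
  qed
  with single show ?case by (intro exI[of _ g'] ballI conjI impI) simp_all
qed

lemma not_free_expansion:
  assumes F: "simple_graph F" and H: "uniform_hypergraph r H" and r: "r \<ge> 2"
    and inj: "inj_on f (verts F)" and fV: "f ` verts F \<subseteq> verts H"
    and g: "\<forall>e\<in>edges F. g e \<in> edges H \<and> f ` e \<subseteq> g e \<and> g e \<inter> f ` verts F = f ` e \<and>
           (\<forall>d\<in>edges F. d \<noteq> e \<longrightarrow> (g d - f ` d) \<inter> (g e - f ` e) = {})"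
  shows "\<not> is_free (expansion r F) H"
proof -
  have "\<exists>b. bij_betw b {..<r - 2} (g e - f ` e)" if "e \<in> edges F" for e
  proof -
    have e: "e \<subseteq> verts F" "card e = 2" using F that by (auto simp: uniform_hypergraph_def)
    have "finite (g e)" "card (g e) = r"
      using g H that r by (auto simp: uniform_hypergraph_def intro: card_ge_0_finite)
    moreover have "card (f ` e) = 2" using card_image[OF inj_on_subset[OF inj e(1)]] e by simp
    ultimately have "card (g e - f ` e) = r - 2"
      using g that by (metis card_Diff_subset finite_subset)
    then show ?thesis using \<open>finite (g e)\<close>
      by (metis card_lessThan finite_Diff finite_lessThan finite_same_card_bij)
  qed
  then obtain b where b: "\<And>e. e \<in> edges F \<Longrightarrow> bij_betw (b e) {..<r - 2} (g e - f ` e)"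
    by metis
  define h where "h = case_sum f (\<lambda>(e, i). b e i)"
  have bin: "b e i \<in> g e - f ` e" if "e \<in> edges F" "i < r - 2" for e i
    using bij_betwE[OF b[OF that(1)]] that(2) by simp
  have new: "b e i \<notin> f ` verts F" if "e \<in> edges F" "i < r - 2" for e i
    using bin[OF that] g that(1) by blast
  have eq: "e = d \<and> i = j"
    if "e \<in> edges F" "i < r - 2" "d \<in> edges F" "j < r - 2" "b e i = b d j" for e i d j
  proof -
    \<comment> \<open>A common value would lie in both leftover sets, which are disjoint for
      distinct edges.\<close>
    have "e = d" using bin[OF that(1,2)] bin[OF that(3,4)] g that by (metis IntI empty_iff)
    then show ?thesis
      using that b[OF that(1)] by (auto simp: bij_betw_def inj_on_def)
  qed
  have split: "(\<exists>u\<in>verts F. x = Inl u \<and> h x = f u) \<or>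
      (\<exists>e\<in>edges F. \<exists>i<r - 2. x = Inr (e, i) \<and> h x = b e i)"
    if "x \<in> verts (expansion r F)" for x
    using that by (auto simp: expansion_def h_def)
  have "inj_on h (verts (expansion r F))"
  proof (rule inj_onI)
    fix x y assume xy: "x \<in> verts (expansion r F)" "y \<in> verts (expansion r F)" "h x = h y"
    from split[OF xy(1)] show "x = y"
    proof (elim disjE bexE exE conjE)
      fix u assume u: "u \<in> verts F" "x = Inl u" "h x = f u"
      from split[OF xy(2)] show ?thesis
      proof (elim disjE bexE exE conjE)
        fix v assume "v \<in> verts F" "y = Inl v" "h y = f v"
        then show ?thesis using u xy(3) inj by (simp add: inj_on_eq_iff)
      next
        fix d j assume "d \<in> edges F" "j < r - 2" "h y = b d j"
        then show ?thesis using new[of d j] u xy(3) by (metis imageI)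
      qed
    next
      fix e i assume e: "e \<in> edges F" "i < r - 2" "x = Inr (e, i)" "h x = b e i"
      from split[OF xy(2)] show ?thesis
      proof (elim disjE bexE exE conjE)
        fix v assume "v \<in> verts F" "h y = f v"
        then show ?thesis using new[OF e(1,2)] e(4) xy(3) by (metis imageI)
      next
        fix d j assume "d \<in> edges F" "j < r - 2" "y = Inr (d, j)" "h y = b d j"
        then show ?thesis using eq[OF e(1,2), of d j] e(3,4) xy(3) by simp
      qed
    qed
  qed
  moreover have "h ` verts (expansion r F) \<subseteq> verts H"
  proof -
    have "b e i \<in> verts H" if "e \<in> edges F" "i < r - 2" for e i
      using bin[OF that] g that(1) H by (auto simp: uniform_hypergraph_def)
    then show ?thesis using fV by (auto simp: expansion_def h_def)
  qed
  moreover have "h ` (Inl ` e \<union> Inr ` ({e} \<times> {..<r - 2})) \<in> edges H" if "e \<in> edges F" for e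
  proof -
    have "h ` (Inl ` e \<union> Inr ` ({e} \<times> {..<r - 2})) = f ` e \<union> b e ` {..<r - 2}"
      by (force simp: h_def)
    also have "\<dots> = g e"
      using b[OF that] g that by (auto simp: bij_betw_def)
    finally show ?thesis using g that by simp
  qed
  ultimately show ?thesis
    unfolding not_is_free_iff by (intro exI[of _ h]) (auto simp: expansion_def)
qed

section \<open>Upper bound: the graph of covered pairs\<close>

text \<open>The source of the error term: the cleaning loses at most \<open>k\<close> edges per set
  of the shadow.\<close>

lemma card_shadow_le:
  assumes "uniform_hypergraph r H"
  shows "card (shadow (edges H)) \<le> card (verts H) ^ (r - 1)"
proof -
  have fin: "finite (verts H)" using assms by (simp add: uniform_hypergraph_def)
  have "shadow (edges H) \<subseteq> {T. T \<subseteq> verts H \<and> card T = r - 1}"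
    using assms by (fastforce simp: shadow_def uniform_hypergraph_def)
  then have "card (shadow (edges H)) \<le> card {T. T \<subseteq> verts H \<and> card T = r - 1}"
    using fin by (intro card_mono) auto
  also have "\<dots> = card (verts H) choose (r - 1)" using n_subsets[OF fin] by simp
  also have "\<dots> \<le> card (verts H) ^ (r - 1)"
    by (cases "r - 1 \<le> card (verts H)") (auto intro: binomial_le_pow simp: binomial_eq_0)
  finally show ?thesis .
qed

text \<open>The constant \<open>k\<close> bounds the number of vertices to avoid while expanding a
  copy of \<open>F\<close>: those of the copy itself and \<open>r\<close> for each hyperedge
  chosen.\<close>

lemma ex_uniform_le_ex_count:
  fixes F :: "'a hypergraph"
  assumes F: "simple_graph F" and r: "r \<ge> 2"
  defines "k \<equiv> card (verts F) + r * card (edges F)"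
  shows "ex_uniform r n (expansion r F) \<le> ex_count n (complete_graph r) F + k * n ^ (r - 1)"
  unfolding ex_uniform_def
proof (rule Sup_nat_le)
  fix x assume "x \<in> {card (edges G) | G :: nat hypergraph.
          uniform_hypergraph r G \<and> card (verts G) = n \<and> is_free (expansion r F) G}"
  then obtain H :: "nat hypergraph" where H: "uniform_hypergraph r H" "card (verts H) = n"
    "is_free (expansion r F) H" and x: "x = card (edges H)" by blast
  have unif: "\<forall>e\<in>edges H. finite e \<and> card e = r"
    using H(1) by (auto simp: uniform_hypergraph_def intro: finite_subset)
  have finF: "finite (verts F)" using F by (simp add: uniform_hypergraph_def)
  have finH: "finite (verts H)" using H by (simp add: uniform_hypergraph_def)
  obtain E where E: "E \<subseteq> edges H" and codeg: "\<forall>T\<in>shadow E. k < card (link E T)"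
    and cE: "card (edges H) + k * card (shadow E) \<le> card E + k * card (shadow (edges H))"
    using min_codegree_subfamily[OF uniform_hypergraph_finite_edges[OF H(1)], of k] unif by blast
  \<comment> \<open>Only pairs covered by the cleaned family \<open>E\<close> become edges, while
    all vertices of \<open>H\<close> are kept so that \<open>G\<close> still has \<open>n\<close> of
    them.\<close>
  define G where "G = (verts H, {p. card p = 2 \<and> (\<exists>e\<in>E. p \<subseteq> e)})"
  have EV: "\<forall>e\<in>E. e \<subseteq> verts H" using E H(1) by (auto simp: uniform_hypergraph_def)
  have G: "simple_graph G" "card (verts G) = n"
    using finH EV H(2) by (auto simp: uniform_hypergraph_def G_def)
  have "is_free F G"
  proof (rule ccontr)
    assume "\<not> is_free F G"
    then obtain f where f: "inj_on f (verts F)" "f ` verts F \<subseteq> verts H"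
      "\<forall>e\<in>edges F. \<exists>d\<in>E. f ` e \<subseteq> d"
      by (auto simp: not_is_free_iff G_def)
    have "\<exists>g. \<forall>j\<in>edges F. g j \<in> E \<and> f ` j \<subseteq> g j \<and> g j \<inter> f ` verts F = f ` j \<and>
        (\<forall>i\<in>edges F. i \<noteq> j \<longrightarrow> (g i - f ` i) \<inter> (g j - f ` j) = {})"
    proof (rule greedy_edges[OF codeg, of r "edges F" "f ` verts F" "\<lambda>e. f ` e"])
      show "card (f ` verts F) + r * card (edges F) \<le> k"
        using card_image_le[OF finF] by (simp add: k_def)
      show "finite (edges F)" by (rule uniform_hypergraph_finite_edges[OF F])
      show "f ` e \<subseteq> f ` verts F" if "e \<in> edges F" for e
        using F that by (auto simp: uniform_hypergraph_def)
    qed (use f unif E finF in auto)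
    then obtain g where g: "\<forall>j\<in>edges F. g j \<in> E \<and> f ` j \<subseteq> g j \<and> g j \<inter> f ` verts F = f ` j \<and>
        (\<forall>i\<in>edges F. i \<noteq> j \<longrightarrow> (g i - f ` i) \<inter> (g j - f ` j) = {})" ..
    have "\<not> is_free (expansion r F) H"
    proof (rule not_free_expansion[OF F H(1) r f(1,2)], intro ballI)
      fix e assume "e \<in> edges F"
      then show "g e \<in> edges H \<and> f ` e \<subseteq> g e \<and> g e \<inter> f ` verts F = f ` e \<and>
          (\<forall>d\<in>edges F. d \<noteq> e \<longrightarrow> (g d - f ` d) \<inter> (g e - f ` e) = {})"
        using bspec[OF g] subsetD[OF E] by simp
    qed
    then show False using H(3) by simp
  qed
  then have "card (cliques r G) \<le> ex_count n (complete_graph r) F"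
    using card_cliques_le_ex_count[OF G] by blast
  \<comment> \<open>Every pair inside a hyperedge of \<open>E\<close> is covered by that very
    hyperedge.\<close>
  moreover have "E \<subseteq> cliques r G" using E EV unif by (auto simp: cliques_def G_def)
  moreover have "finite (cliques r G)"
    using finH by (auto simp: cliques_def G_def)
  ultimately have "card E \<le> ex_count n (complete_graph r) F"
    by (meson card_mono le_trans)
  moreover have "k * card (shadow (edges H)) \<le> k * n ^ (r - 1)"
    using card_shadow_le[OF H(1)] H(2) by simp
  ultimately show "x \<le> ex_count n (complete_graph r) F + k * n ^ (r - 1)"
    using cE x by linarith
qed

theorem theorem1p2:
  fixes F :: "'a hypergraph" and r :: nat
  assumes "simple_graph F" and "r \<ge> 2"
  shows "(\<lambda>n. real (ex_uniform r n (expansion r F)) - real (ex_count n (complete_graph r) F))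
           \<in> O(\<lambda>n. real n ^ (r - 1))"
proof (rule bigoI)
  define k where "k = card (verts F) + r * card (edges F)"
  have "norm (real (ex_uniform r n (expansion r F)) - real (ex_count n (complete_graph r) F))
        \<le> real k * norm (real n ^ (r - 1))" for n
  proof -
    have "real (ex_uniform r n (expansion r F))
        \<le> real (ex_count n (complete_graph r) F) + real k * real n ^ (r - 1)"
      using ex_uniform_le_ex_count[OF assms, of n, folded k_def]
      by (metis of_nat_add of_nat_le_iff of_nat_mult of_nat_power)
    \<comment> \<open>The lower bound makes the difference nonnegative, which removes the norm; the
      estimate holds for every \<open>n\<close>.\<close>
    then show ?thesis using ex_count_le_ex_uniform[OF assms(1), of n r] by simp
  qed
  then show "\<forall>\<^sub>F n in sequentially.
      norm (real (ex_uniform r n (expansion r F)) - real (ex_count n (complete_graph r) F))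
        \<le> real k * norm (real n ^ (r - 1))" by simp
qed

end
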